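(* Let $V$ be a b-complete subsemimodule of $\mathbb{R}_{\max}^n$ and let $x\in\mathbb{R}_{\max}^n$ be such that $d(x,V)<+\infty$. Let $S:=\operatorname{Supp} x$, let $V^{(x)}:=(V\cap[[x]])\cup\{-\infty\}$, and define $$x':=x|_S\in\mathbb{R}^S,\qquad V':=V^{(x)}|_S=\{v|_S\mid v\in V^{(x)}\}\subset\mathbb{R}^S\cup\{-\infty|_S\}.$$ Then $V'$ is a b-complete subsemimodule of $\mathbb{R}_{\max}^S$, contained in $\mathbb{R}^S\cup\{-\infty|_S\}$, $x'\in\mathbb{R}_{\max}^S$, and $$d(x,V)=\widetilde d(x',V'),$$ where $\widetilde d$ is the Hilbert projective distance on $\mathbb{R}_{\max}^S$. Furthermore, an element $v\in V$ is a best approximation of $x$ in $V$ if and only if $\operatorname{Supp} v=\operatorname{Supp} x$ and $v|_S$ is a best approximation of $x'$ in $V'$.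
   Context: $\mathbb{R}_{\max}=\mathbb{R}\cup\{-\infty\}$ with addition $\oplus=\max$ and multiplication $\otimes=+$; $\overline{\mathbb{R}}=\mathbb{R}\cup\{-\infty,+\infty\}$ with the convention $(-\infty)+(+\infty)=(+\infty)+(-\infty)=-\infty$. $\mathbb{R}_{\max}^n$ (and $\mathbb{R}_{\max}^S$ for $S\subset[n]=\{1,\dots,n\}$) has the entrywise order; $x\lambda$ denotes the vector with entries $x_i+\lambda$; $-\infty$ also denotes the vector with all entries $-\infty$. $\operatorname{Supp} x:=\{i\in[n]\mid x_i\in\mathbb{R}\}$; $x|_S:=(x_i)_{i\in S}$. The part $[[x]]$ of $x$ is the set of all vectors $y$ for which there exist $\lambda,\mu\in\mathbb{R}$ with $x\lambda\leq y\leq x\mu$. For vectors, $x\backslash y:=\max\{\lambda\in\overline{\mathbb{R}}\mid x\lambda\leq y\}$; Hilbert's projective distance (on $\mathbb{R}_{\max}^n$, and likewise on $\mathbb{R}_{\max}^S$) is $d(x,y):=-\big((x\backslash y)+(y\backslash x)\big)\in\overline{\mathbb{R}}$; $d(x,V):=\inf_{v\in V}d(x,v)$; a best approximation of $x$ in $V$ is $v_0\in V$ with $d(x,v_0)=d(x,V)$. A subsemimodule is a subset containing the vector $-\infty$ and stable under entrywise max and under $x\mapsto x\lambda$ for all $\lambda\in\mathbb{R}_{\max}$; it is b-complete if the supremum of any of its subsets that is bounded from above belongs to it. *)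

theory Defs
  imports "HOL-Library.Extended_Real" "HOL-Library.FuncSet"
begin

text \<open>
  The extended reals are the type \<^typ>\<open>ereal\<close>, but its addition satisfies
  \<open>(-\<infinity>) + \<infinity> = \<infinity>\<close>; here the opposite convention is needed, so that
  \<open>-\<infinity>\<close> is absorbing.
\<close>

definition mp_times :: "ereal \<Rightarrow> ereal \<Rightarrow> ereal" where
  "mp_times a b = (if a = -\<infinity> \<or> b = -\<infinity> then -\<infinity> else a + b)"

definition Rmax :: "ereal set" where
  "Rmax = {a. a \<noteq> \<infinity>}"

text \<open>
  Vectors indexed by a set \<open>I\<close> are extensional functions on \<open>I\<close>, so that
  \<open>x|\<^sub>S\<close> is \<^term>\<open>restrict x S\<close>.  All notions below carry the index set as a
  parameter, because the same notion is used for vectors over \<open>[n]\<close> and over \<open>S \<subseteq> [n]\<close>.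
\<close>

definition Rmax_vec :: "'i set \<Rightarrow> ('i \<Rightarrow> ereal) set" where
  "Rmax_vec I = I \<rightarrow>\<^sub>E Rmax"

definition real_vec :: "'i set \<Rightarrow> ('i \<Rightarrow> ereal) set" where
  "real_vec I = I \<rightarrow>\<^sub>E range ereal"

definition vec_le :: "'i set \<Rightarrow> ('i \<Rightarrow> ereal) \<Rightarrow> ('i \<Rightarrow> ereal) \<Rightarrow> bool" where
  "vec_le I x y \<longleftrightarrow> (\<forall>i\<in>I. x i \<le> y i)"

definition vec_scale :: "'i set \<Rightarrow> ('i \<Rightarrow> ereal) \<Rightarrow> ereal \<Rightarrow> ('i \<Rightarrow> ereal)" where
  "vec_scale I x l = (\<lambda>i\<in>I. mp_times (x i) l)"

definition vec_max :: "'i set \<Rightarrow> ('i \<Rightarrow> ereal) \<Rightarrow> ('i \<Rightarrow> ereal) \<Rightarrow> ('i \<Rightarrow> ereal)" where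
  "vec_max I x y = (\<lambda>i\<in>I. max (x i) (y i))"

definition vec_bot :: "'i set \<Rightarrow> ('i \<Rightarrow> ereal)" where
  "vec_bot I = (\<lambda>i\<in>I. -\<infinity>)"

text \<open>
  The supremum for the entrywise order; if \<open>A\<close> is bounded from above in \<open>Rmax_vec I\<close>
  it lies in \<open>Rmax_vec I\<close>, and for \<open>A = {}\<close> it is \<open>vec_bot I\<close>.
\<close>

definition vec_Sup :: "'i set \<Rightarrow> ('i \<Rightarrow> ereal) set \<Rightarrow> ('i \<Rightarrow> ereal)" where
  "vec_Sup I A = (\<lambda>i\<in>I. SUP a\<in>A. a i)"

definition Supp :: "'i set \<Rightarrow> ('i \<Rightarrow> ereal) \<Rightarrow> 'i set" where
  "Supp I x = {i \<in> I. x i \<in> range ereal}"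

definition part :: "'i set \<Rightarrow> ('i \<Rightarrow> ereal) \<Rightarrow> ('i \<Rightarrow> ereal) set" where
  "part I x = {y \<in> Rmax_vec I. \<exists>l m :: real.
     vec_le I (vec_scale I x (ereal l)) y \<and> vec_le I y (vec_scale I x (ereal m))}"

text \<open>
  The residual \<open>x\y\<close>.  The scalar ranges over all of \<^typ>\<open>ereal\<close>, and for
  \<open>x, y \<in> Rmax_vec I\<close> the maximum is attained: the set contains \<open>-\<infinity>\<close> and is closed
  under suprema.
\<close>

definition residual :: "'i set \<Rightarrow> ('i \<Rightarrow> ereal) \<Rightarrow> ('i \<Rightarrow> ereal) \<Rightarrow> ereal" where
  "residual I x y = (GREATEST l. vec_le I (vec_scale I x l) y)"

definition hilbert_dist :: "'i set \<Rightarrow> ('i \<Rightarrow> ereal) \<Rightarrow> ('i \<Rightarrow> ereal) \<Rightarrow> ereal" where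
  "hilbert_dist I x y = - mp_times (residual I x y) (residual I y x)"

definition set_dist :: "'i set \<Rightarrow> ('i \<Rightarrow> ereal) \<Rightarrow> ('i \<Rightarrow> ereal) set \<Rightarrow> ereal" where
  "set_dist I x V = (INF v\<in>V. hilbert_dist I x v)"

definition best_approx :: "'i set \<Rightarrow> ('i \<Rightarrow> ereal) \<Rightarrow> ('i \<Rightarrow> ereal) set \<Rightarrow> ('i \<Rightarrow> ereal) \<Rightarrow> bool" where
  "best_approx I x V v \<longleftrightarrow> v \<in> V \<and> hilbert_dist I x v = set_dist I x V"

definition subsemimodule :: "'i set \<Rightarrow> ('i \<Rightarrow> ereal) set \<Rightarrow> bool" where
  "subsemimodule I V \<longleftrightarrow>
     V \<subseteq> Rmax_vec I \<and> vec_bot I \<in> V \<and>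
     (\<forall>u\<in>V. \<forall>v\<in>V. vec_max I u v \<in> V) \<and>
     (\<forall>v\<in>V. \<forall>l\<in>Rmax. vec_scale I v l \<in> V)"

definition b_complete :: "'i set \<Rightarrow> ('i \<Rightarrow> ereal) set \<Rightarrow> bool" where
  "b_complete I V \<longleftrightarrow>
     (\<forall>A\<subseteq>V. (\<exists>u\<in>Rmax_vec I. \<forall>a\<in>A. vec_le I a u) \<longrightarrow> vec_Sup I A \<in> V)"

end

theory Submission
  imports Defs
begin

text \<open>
  For vectors in \<^term>\<open>Rmax_vec I\<close> the residual \<open>x\y\<close> is the infimum of \<open>y\<^sub>i - x\<^sub>i\<close> over the
  support of \<open>x\<close>, so a finite distance forces equal supports, and over a finite index set the
  part of \<open>x\<close> consists exactly of the vectors with the support of \<open>x\<close>. Hence only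
  \<open>V \<inter> [[x]]\<close> contributes to \<open>d(x, V)\<close>, and there nothing is lost by restricting to the support.
\<close>

section \<open>Supports and restriction to a smaller index set\<close>

lemma Rmax_cases:
  assumes "a \<in> Rmax"
  obtains r where "a = ereal r" | "a = -\<infinity>"
  using assms by (cases a) (auto simp: Rmax_def)

lemma Rmax_vec_apply: "x \<in> Rmax_vec I \<Longrightarrow> i \<in> I \<Longrightarrow> x i \<in> Rmax"
  by (auto simp: Rmax_vec_def)

lemma Rmax_vec_restrict:
  "x \<in> Rmax_vec I \<Longrightarrow> S \<subseteq> I \<Longrightarrow> restrict x S \<in> Rmax_vec S"
  by (auto simp: Rmax_vec_def)

lemma Supp_subset: "Supp I x \<subseteq> I"
  by (auto simp: Supp_def)

lemma not_in_Supp: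
  assumes "x \<in> Rmax_vec I" "i \<in> I" "i \<notin> Supp I x"
  shows "x i = -\<infinity>"
  using Rmax_vec_apply[OF assms(1,2)] assms(2,3) by (auto simp: Supp_def elim: Rmax_cases)

lemma in_Supp_iff: "x \<in> Rmax_vec I \<Longrightarrow> i \<in> Supp I x \<longleftrightarrow> i \<in> I \<and> x i \<noteq> -\<infinity>"
  using not_in_Supp[of x I i] by (auto simp: Supp_def)

lemma Supp_eqI:
  assumes "x \<in> Rmax_vec I" "y \<in> Rmax_vec I" "\<And>i. i \<in> I \<Longrightarrow> x i = -\<infinity> \<longleftrightarrow> y i = -\<infinity>"
  shows "Supp I x = Supp I y"
  using assms by (auto simp: in_Supp_iff)

lemma vec_bot_Rmax_vec: "vec_bot I \<in> Rmax_vec I"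
  by (auto simp: vec_bot_def Rmax_vec_def Rmax_def)

lemma Supp_vec_bot: "Supp I (vec_bot I) = {}"
  by (auto simp: vec_bot_def Supp_def)

lemma restrict_vec_bot: "S \<subseteq> I \<Longrightarrow> restrict (vec_bot I) S = vec_bot S"
  by (auto simp: vec_bot_def fun_eq_iff)

lemma restrict_vec_max: "S \<subseteq> I \<Longrightarrow> restrict (vec_max I u v) S = vec_max S (restrict u S) (restrict v S)"
  by (auto simp: vec_max_def fun_eq_iff)

lemma restrict_vec_scale: "S \<subseteq> I \<Longrightarrow> restrict (vec_scale I v l) S = vec_scale S (restrict v S) l"
  by (auto simp: vec_scale_def fun_eq_iff)

lemma restrict_vec_Sup:
  "S \<subseteq> I \<Longrightarrow> restrict (vec_Sup I A) S = vec_Sup S ((\<lambda>v. restrict v S) ` A)"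
  by (auto simp: vec_Sup_def fun_eq_iff image_image)

section \<open>Residuals and the Hilbert distance\<close>

lemma mp_times_le_iff:
  assumes "a \<in> Rmax" "b \<in> Rmax"
  shows "mp_times a l \<le> b \<longleftrightarrow> a = -\<infinity> \<or> l \<le> b - a"
  using assms by (cases a; cases b; cases l) (auto simp: mp_times_def Rmax_def)

text \<open>Coordinates outside the support of \<open>x\<close> put no constraint on
  \<open>l\<close>, since -\<infinity> is absorbing; every other coordinate bounds \<open>l\<close>
  by \<open>y i - x i\<close>.\<close>

lemma vec_scale_le_iff:
  assumes "x \<in> Rmax_vec I" "y \<in> Rmax_vec I"
  shows "vec_le I (vec_scale I x l) y \<longleftrightarrow> l \<le> (INF i\<in>Supp I x. y i - x i)"
  using assms
  by (auto simp: vec_le_def vec_scale_def le_INF_iff in_Supp_iff mp_times_le_iff Rmax_vec_apply)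

text \<open>The admissible scalars are exactly those below the infimum, so the infimum is itself
  admissible and \<open>GREATEST\<close> is attained there.\<close>

lemma residual_eq_INF:
  assumes "x \<in> Rmax_vec I" "y \<in> Rmax_vec I"
  shows "residual I x y = (INF i\<in>Supp I x. y i - x i)"
  unfolding residual_def vec_scale_le_iff[OF assms] by (rule Greatest_equality) auto

text \<open>The deleted coordinates of \<open>x\<close> stay -\<infinity> under every scaling, so
  both sides have the same admissible scalars, whatever \<open>y\<close> is there.\<close>

lemma residual_restrict:
  assumes "S \<subseteq> I" "\<And>i. i \<in> I - S \<Longrightarrow> x i = -\<infinity>"
  shows "residual S (restrict x S) (restrict y S) = residual I x y"
proof -
  have "vec_le S (vec_scale S (restrict x S) l) (restrict y S) = vec_le I (vec_scale I x l) y" for l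
    using assms by (auto simp: vec_le_def vec_scale_def mp_times_def subset_iff)
  then show ?thesis
    by (simp add: residual_def)
qed

lemma hilbert_dist_restrict:
  assumes "S \<subseteq> I" "\<And>i. i \<in> I - S \<Longrightarrow> x i = -\<infinity>" "\<And>i. i \<in> I - S \<Longrightarrow> y i = -\<infinity>"
  shows "hilbert_dist S (restrict x S) (restrict y S) = hilbert_dist I x y"
  unfolding hilbert_dist_def
  using residual_restrict[of S I x y] residual_restrict[of S I y x] assms by simp

text \<open>A coordinate with \<open>x i\<close> real and \<open>y i = -\<infinity>\<close>
  contributes -\<infinity> to the infimum.\<close>

lemma Supp_mono_of_residual:
  assumes "x \<in> Rmax_vec I" "y \<in> Rmax_vec I" "residual I x y \<noteq> -\<infinity>"
  shows "Supp I x \<subseteq> Supp I y"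
proof
  fix i assume i: "i \<in> Supp I x"
  then have "residual I x y \<le> y i - x i"
    using assms by (auto simp: residual_eq_INF intro: INF_lower)
  with assms(3) i have "y i \<noteq> -\<infinity>"
    by (cases "x i") (auto simp: Supp_def)
  with i assms(2) show "i \<in> Supp I y"
    using Supp_subset by (fastforce simp: in_Supp_iff)
qed

lemma Supp_eq_of_hilbert_dist:
  assumes "x \<in> Rmax_vec I" "y \<in> Rmax_vec I" "hilbert_dist I x y \<noteq> \<infinity>"
  shows "Supp I y = Supp I x"
proof -
  \<comment> \<open>As -\<infinity> is absorbing in \<open>mp_times\<close>, one residual equal to
    -\<infinity> already makes the distance \<infinity>.\<close>
  have "residual I x y \<noteq> -\<infinity>" "residual I y x \<noteq> -\<infinity>"
    using assms(3) by (auto simp: hilbert_dist_def mp_times_def)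
  then show ?thesis
    using Supp_mono_of_residual assms by blast
qed

section \<open>Parts as classes of vectors with equal support\<close>

lemma Supp_eq_of_part:
  assumes "x \<in> Rmax_vec I" "y \<in> part I x"
  shows "Supp I y = Supp I x"
proof (rule Supp_eqI)
  obtain l m :: real where "vec_le I (vec_scale I x (ereal l)) y"
      "vec_le I y (vec_scale I x (ereal m))"
    using assms(2) by (auto simp: part_def)
  moreover fix i assume "i \<in> I"
  ultimately have "mp_times (x i) (ereal l) \<le> y i" "y i \<le> mp_times (x i) (ereal m)"
    by (auto simp: vec_le_def vec_scale_def)
  then show "y i = -\<infinity> \<longleftrightarrow> x i = -\<infinity>"
    by (cases "x i") (auto simp: mp_times_def)
qed (use assms in \<open>auto simp: part_def\<close>)

lemma part_iff_Supp_eq: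
  assumes "finite I" "x \<in> Rmax_vec I"
  shows "y \<in> part I x \<longleftrightarrow> y \<in> Rmax_vec I \<and> Supp I y = Supp I x"
proof
  assume "y \<in> part I x"
  then show "y \<in> Rmax_vec I \<and> Supp I y = Supp I x"
    using Supp_eq_of_part assms by (auto simp: part_def)
next
  assume y: "y \<in> Rmax_vec I \<and> Supp I y = Supp I x"
  define D where "D i = \<bar>real_of_ereal (y i) - real_of_ereal (x i)\<bar>" for i
  \<comment> \<open>One shift has to serve all coordinates. The sum of the nonnegative
    \<open>D i\<close> dominates each of them, also when \<open>I\<close> is empty; this is where
    finiteness of \<open>I\<close> enters.\<close>
  define m where "m = (\<Sum>i\<in>I. D i)"
  have "mp_times (x i) (ereal (- m)) \<le> y i \<and> y i \<le> mp_times (x i) (ereal m)" if i: "i \<in> I" for i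
  proof (cases "i \<in> Supp I x")
    case True
    moreover have "i \<in> Supp I y"
      using True y by simp
    ultimately obtain a b where "x i = ereal a" "y i = ereal b"
      unfolding Supp_def by blast
    moreover have "D i \<le> m"
      unfolding m_def by (rule member_le_sum) (use assms(1) i in \<open>auto simp: D_def\<close>)
    ultimately show ?thesis
      by (auto simp: D_def mp_times_def)
  next
    case False
    then have "x i = -\<infinity>" "y i = -\<infinity>"
      using i y assms not_in_Supp by metis+
    then show ?thesis
      by (simp add: mp_times_def)
  qed
  then have "vec_le I (vec_scale I x (ereal (- m))) y \<and> vec_le I y (vec_scale I x (ereal m))"
    by (simp add: vec_le_def vec_scale_def)
  with y show "y \<in> part I x"
    unfolding part_def by blast
qed

section \<open>The semimodule cut down to the part of \<open>x\<close>\<close>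

locale part_restriction =
  fixes I :: "'i set" and V :: "('i \<Rightarrow> ereal) set" and x :: "'i \<Rightarrow> ereal"
  assumes finite_I: "finite I"
    and subsemi: "subsemimodule I V"
    and complete: "b_complete I V"
    and x_Rmax_vec: "x \<in> Rmax_vec I"
begin

definition S where "S = Supp I x"

definition Vx where "Vx = (V \<inter> part I x) \<union> {vec_bot I}"

definition V' where "V' = (\<lambda>v. restrict v S) ` Vx"

lemma S_subset: "S \<subseteq> I"
  by (simp add: S_def Supp_subset)

lemma V_Rmax_vec: "v \<in> V \<Longrightarrow> v \<in> Rmax_vec I"
  using subsemi by (auto simp: subsemimodule_def)

text \<open>Replaces the two-sided bounds of \<open>part\<close> by a condition on supports, which
  is easy to follow through maxima, scalings and suprema.\<close>

lemma Vx_iff: "v \<in> Vx \<longleftrightarrow> v \<in> V \<and> (Supp I v = S \<or> v = vec_bot I)"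
  using subsemi
  by (auto simp: Vx_def part_iff_Supp_eq[OF finite_I x_Rmax_vec] S_def V_Rmax_vec subsemimodule_def)

lemma Vx_I: "v \<in> V \<Longrightarrow> Supp I v = S \<Longrightarrow> v \<in> Vx"
  by (simp add: Vx_iff)

lemma Vx_outside: "v \<in> Vx \<Longrightarrow> i \<in> I - S \<Longrightarrow> v i = -\<infinity>"
  by (auto simp: Vx_iff vec_bot_def intro: not_in_Supp V_Rmax_vec)

lemma x_outside: "i \<in> I - S \<Longrightarrow> x i = -\<infinity>"
  using x_Rmax_vec by (auto simp: S_def intro: not_in_Supp)

lemma restrict_real_vec:
  assumes "Supp I v = S"
  shows "restrict v S \<in> real_vec S"
  unfolding assms[symmetric] by (auto simp: real_vec_def Supp_def)

lemma V'_subset: "V' \<subseteq> real_vec S \<union> {vec_bot S}"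
  using restrict_real_vec S_subset by (auto simp: V'_def Vx_iff restrict_vec_bot)

lemma vec_max_Vx:
  assumes "u \<in> Vx" "v \<in> Vx"
  shows "vec_max I u v \<in> Vx"
proof -
  have V: "vec_max I u v \<in> V"
    using assms subsemi by (auto simp: Vx_iff subsemimodule_def)
  have R: "u \<in> Rmax_vec I" "v \<in> Rmax_vec I" "vec_max I u v \<in> Rmax_vec I"
    using V assms V_Rmax_vec by (auto simp: Vx_iff)
  have "Supp I (vec_max I u v) = Supp I u \<union> Supp I v"
    using R by (auto simp: in_Supp_iff vec_max_def max_def)
  \<comment> \<open>If at least one of \<open>u\<close>, \<open>v\<close> has support
    \<open>S\<close>, so does the maximum; this covers the case where both are bottom.\<close>
  moreover have "vec_max I (vec_bot I) (vec_bot I) = vec_bot I"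
    by (auto simp: vec_max_def vec_bot_def)
  ultimately show ?thesis
    using assms V by (auto simp: Vx_iff Supp_vec_bot)
qed

lemma vec_scale_Vx:
  assumes "v \<in> Vx" "l \<in> Rmax"
  shows "vec_scale I v l \<in> Vx"
proof -
  have V: "vec_scale I v l \<in> V"
    using assms subsemi by (auto simp: Vx_iff subsemimodule_def)
  show ?thesis
  \<comment> \<open>The degenerate cases give bottom; a real scalar keeps the support.\<close>
  proof (cases "l = -\<infinity> \<or> v = vec_bot I")
    case True
    then have "vec_scale I v l = vec_bot I"
      by (auto simp: vec_scale_def vec_bot_def mp_times_def)
    with V show ?thesis
      by (simp add: Vx_iff)
  next
    case False
    have v: "v \<in> Rmax_vec I" "Supp I v = S"
      using assms False V_Rmax_vec by (auto simp: Vx_iff)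
    have "Supp I (vec_scale I v l) = Supp I v"
      using v(1) V_Rmax_vec[OF V] False by (intro Supp_eqI) (auto simp: vec_scale_def mp_times_def)
    with v V show ?thesis
      by (simp add: Vx_iff)
  qed
qed

text \<open>Membership in \<open>V\<close> will come from b-completeness; only the support is at
  stake. One member with support \<open>S\<close> keeps the supremum above -\<infinity> on
  \<open>S\<close>, while all members are -\<infinity> off \<open>S\<close>.\<close>

lemma vec_Sup_Vx:
  assumes B: "B \<subseteq> Vx" and V: "vec_Sup I B \<in> V"
  shows "vec_Sup I B \<in> Vx"
proof (cases "B \<subseteq> {vec_bot I}")
  \<comment> \<open>This includes empty \<open>B\<close>, whose supremum in \<open>ereal\<close> is
    -\<infinity>.\<close>
  case True
  then have "vec_Sup I B = vec_bot I"
    by (auto simp: subset_singleton_iff vec_Sup_def vec_bot_def bot_ereal_def)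
  with V show ?thesis
    by (simp add: Vx_iff)
next
  case False
  then obtain b where b: "b \<in> B" "Supp I b = S" "b \<in> Rmax_vec I"
    using B V_Rmax_vec by (auto simp: subset_iff Vx_iff)
  have "Supp I (vec_Sup I B) = Supp I b"
  proof (rule Supp_eqI)
    fix i assume i: "i \<in> I"
    show "vec_Sup I B i = -\<infinity> \<longleftrightarrow> b i = -\<infinity>"
    proof
      assume "vec_Sup I B i = -\<infinity>"
      moreover have "b i \<le> vec_Sup I B i"
        using i b by (auto simp: vec_Sup_def intro: SUP_upper)
      ultimately show "b i = -\<infinity>"
        by simp
    next
      assume "b i = -\<infinity>"
      with i b have "i \<in> I - S"
        by (auto simp: in_Supp_iff)
      then have "(SUP a\<in>B. a i) \<le> -\<infinity>"
        using B Vx_outside by (intro SUP_least) auto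
      with i show "vec_Sup I B i = -\<infinity>"
        by (simp add: vec_Sup_def)
    qed
  qed (use V b V_Rmax_vec in auto)
  with b V show ?thesis
    by (simp add: Vx_iff)
qed

lemma subsemimodule_V': "subsemimodule S V'"
  unfolding subsemimodule_def
proof (intro conjI ballI)
  show "V' \<subseteq> Rmax_vec S"
    using S_subset V_Rmax_vec by (auto simp: V'_def Vx_iff intro!: Rmax_vec_restrict[of _ I])
  show "vec_bot S \<in> V'"
    unfolding V'_def using S_subset by (intro image_eqI[of _ _ "vec_bot I"])
      (auto simp: restrict_vec_bot Vx_def)
next
  fix u v assume "u \<in> V'" "v \<in> V'"
  then show "vec_max S u v \<in> V'"
    using vec_max_Vx by (auto simp: V'_def restrict_vec_max[OF S_subset, symmetric])
next
  fix v l assume "v \<in> V'" "l \<in> Rmax"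
  then show "vec_scale S v l \<in> V'"
    using vec_scale_Vx by (auto simp: V'_def restrict_vec_scale[OF S_subset, symmetric])
qed

lemma b_complete_V': "b_complete S V'"
  unfolding b_complete_def
proof (intro allI impI)
  fix A assume "A \<subseteq> V'" and bdd: "\<exists>u\<in>Rmax_vec S. \<forall>a\<in>A. vec_le S a u"
  \<comment> \<open>Completeness is known for \<open>V\<close> only, so \<open>A\<close> is lifted
    to a family of vectors over \<open>I\<close>.\<close>
  then obtain B where B: "B \<subseteq> Vx" "A = (\<lambda>v. restrict v S) ` B"
    unfolding V'_def by (rule_tac subset_imageE)
  obtain u where u: "u \<in> Rmax_vec S" "\<And>b. b \<in> B \<Longrightarrow> vec_le S (restrict b S) u"
    using bdd B by auto
  \<comment> \<open>Extending the bound by -\<infinity> suffices, because members of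
    \<open>Vx\<close> are -\<infinity> off \<open>S\<close>.\<close>
  let ?u = "\<lambda>i\<in>I. if i \<in> S then u i else -\<infinity>"
  have "?u \<in> Rmax_vec I"
    using Rmax_vec_apply[OF u(1)] by (auto simp: Rmax_vec_def Rmax_def)
  moreover have "vec_le I b ?u" if "b \<in> B" for b
    using u(2)[OF that] that B(1) Vx_outside by (auto simp: vec_le_def)
  moreover have "B \<subseteq> V"
    using B(1) by (auto simp: Vx_iff)
  ultimately have "vec_Sup I B \<in> V"
    using complete unfolding b_complete_def by blast
  then have "vec_Sup I B \<in> Vx"
    using B(1) vec_Sup_Vx by blast
  then show "vec_Sup S A \<in> V'"
    by (auto simp: V'_def B(2) restrict_vec_Sup[OF S_subset, symmetric])
qed

section \<open>Distances and best approximations\<close>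

lemma hilbert_dist_Vx:
  "v \<in> Vx \<Longrightarrow> hilbert_dist S (restrict x S) (restrict v S) = hilbert_dist I x v"
  using S_subset x_outside Vx_outside by (intro hilbert_dist_restrict) auto

lemma Supp_eq_S: "v \<in> V \<Longrightarrow> hilbert_dist I x v \<noteq> \<infinity> \<Longrightarrow> Supp I v = S"
  unfolding S_def using Supp_eq_of_hilbert_dist x_Rmax_vec V_Rmax_vec by blast

lemma set_dist_V': "set_dist S (restrict x S) V' = set_dist I x V"
proof -
  have "set_dist S (restrict x S) V' = (INF v\<in>Vx. hilbert_dist I x v)"
    by (auto simp: set_dist_def V'_def image_image hilbert_dist_Vx intro!: INF_cong)
  also have "\<dots> = set_dist I x V"
    unfolding set_dist_def
  proof (rule antisym)
    show "(INF v\<in>V. hilbert_dist I x v) \<le> (INF v\<in>Vx. hilbert_dist I x v)"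
      by (rule INF_superset_mono) (auto simp: Vx_iff)
    show "(INF v\<in>Vx. hilbert_dist I x v) \<le> (INF v\<in>V. hilbert_dist I x v)"
    proof (rule INF_greatest)
      fix v assume v: "v \<in> V"
      show "(INF v\<in>Vx. hilbert_dist I x v) \<le> hilbert_dist I x v"
      \<comment> \<open>Vectors of \<open>V\<close> outside \<open>Vx\<close> lie at distance
        \<infinity> and cannot lower the infimum.\<close>
      proof (cases "hilbert_dist I x v = \<infinity>")
        case False
        then have "v \<in> Vx"
          using v by (simp add: Vx_I Supp_eq_S)
        then show ?thesis
          by (rule INF_lower)
      qed simp
    qed
  qed
  finally show ?thesis .
qed

text \<open>Finiteness of the distance to \<open>V\<close> forces a best approximation to have
  support \<open>S\<close>. Conversely the support must be required, since
  \<open>restrict v S\<close> forgets the entries off \<open>S\<close>; once it is \<open>S\<close>,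
  both distances of \<open>v\<close> agree, as do both infima.\<close>

lemma best_approx_V'_iff:
  assumes "set_dist I x V < \<infinity>" "v \<in> V"
  shows "best_approx I x V v \<longleftrightarrow> Supp I v = S \<and> best_approx S (restrict x S) V' (restrict v S)"
proof -
  have "Supp I v = S" if "hilbert_dist I x v = set_dist I x V"
    using that assms by (simp add: Supp_eq_S)
  moreover have "restrict v S \<in> V'" if "Supp I v = S"
    using Vx_I[OF assms(2) that] by (simp add: V'_def)
  ultimately show ?thesis
    using assms(2) hilbert_dist_Vx[OF Vx_I[OF assms(2)]] by (auto simp: best_approx_def set_dist_V')
qed

end

theorem proposition3p2:
  fixes n :: nat
    and V Vx V' :: "(nat \<Rightarrow> ereal) set"
    and x x' :: "nat \<Rightarrow> ereal"
    and S :: "nat set"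
  assumes "subsemimodule {1..n} V"
    and "b_complete {1..n} V"
    and "x \<in> Rmax_vec {1..n}"
    and "set_dist {1..n} x V < \<infinity>"
    and "S = Supp {1..n} x"
    and "Vx = (V \<inter> part {1..n} x) \<union> {vec_bot {1..n}}"
    and "x' = restrict x S"
    and "V' = {restrict v S | v. v \<in> Vx}"
  shows "subsemimodule S V' \<and> b_complete S V' \<and>
         V' \<subseteq> real_vec S \<union> {vec_bot S} \<and>
         x' \<in> real_vec S \<and> x' \<in> Rmax_vec S \<and>
         set_dist {1..n} x V = set_dist S x' V' \<and>
         (\<forall>v\<in>V. best_approx {1..n} x V v \<longleftrightarrow>
            Supp {1..n} v = Supp {1..n} x \<and> best_approx S x' V' (restrict v S))"
proof -
  interpret P: part_restriction "{1..n}" V x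
    using assms by unfold_locales auto
  have S: "S = P.S"
    unfolding assms(5) P.S_def ..
  have V': "V' = P.V'"
    unfolding assms(6,8) S P.V'_def P.Vx_def by blast
  have "x' \<in> real_vec S" "x' \<in> Rmax_vec S"
    using P.restrict_real_vec[OF P.S_def[symmetric]] Rmax_vec_restrict[OF assms(3) P.S_subset]
    by (simp_all add: assms(7) S)
  moreover have "Supp {1..n} x = P.S"
    by (rule P.S_def[symmetric])
  ultimately show ?thesis
    using P.subsemimodule_V' P.b_complete_V' P.V'_subset P.set_dist_V'
      P.best_approx_V'_iff[OF assms(4)]
    unfolding assms(7) V' S by simp
qed

end
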